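(* Let $d_0,d_1,d_2,n$ be positive integers, and let $X\in\mathbb{R}^{d_0\times n}$ and $Y\in\mathbb{R}^{d_2\times n}$ be arbitrary matrices. Consider the two-layer linear network problem $$\min_{W_1\in\mathbb{R}^{d_1\times d_0},\,W_2\in\mathbb{R}^{d_2\times d_1}}\ \tfrac12\|W_2W_1X-Y\|^2 .$$ Every local minimum of this problem is global. Moreover, every degenerate saddle point of this problem is a second order saddle.
   Context: $\|\cdot\|$ is the Frobenius norm. A point $(W_2,W_1)$ is degenerate if $\operatorname{rank}(W_2W_1)<\min\{d_0,d_1,d_2\}$. A saddle point is a critical point (point of zero gradient) that is neither a local minimum nor a local maximum. A point is a second order saddle (strict saddle) if the gradient of the objective vanishes there and the Hessian of the objective there has a negative eigenvalue. *)

theory Defs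
  imports "HOL-Analysis.Analysis"
begin

text \<open>A $d \times n$ matrix is an element of \<open>real ^ 'n ^ 'd\<close> with \<open>CARD('d) = d\<close> and
  \<open>CARD('n) = n\<close>; the norm of this type is the Frobenius norm:\<close>

lemma norm_matrix_frobenius:
  fixes A :: "real ^ 'n ^ 'd"
  shows "norm A = sqrt (\<Sum>i\<in>UNIV. \<Sum>j\<in>UNIV. (A $ i $ j)\<^sup>2)"
  by (simp add: norm_vec_def L2_set_def sum_nonneg)

definition local_minimum :: "('a::topological_space \<Rightarrow> real) \<Rightarrow> 'a \<Rightarrow> bool" where
  "local_minimum f x \<longleftrightarrow> (\<forall>\<^sub>F y in nhds x. f x \<le> f y)"

definition local_maximum :: "('a::topological_space \<Rightarrow> real) \<Rightarrow> 'a \<Rightarrow> bool" where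
  "local_maximum f x \<longleftrightarrow> (\<forall>\<^sub>F y in nhds x. f y \<le> f x)"

definition global_minimum :: "('a \<Rightarrow> real) \<Rightarrow> 'a \<Rightarrow> bool" where
  "global_minimum f x \<longleftrightarrow> (\<forall>y. f x \<le> f y)"

definition critical_point :: "('a::real_inner \<Rightarrow> real) \<Rightarrow> 'a \<Rightarrow> bool" where
  "critical_point f x \<longleftrightarrow> GDERIV f x :> 0"

definition saddle_point :: "('a::real_inner \<Rightarrow> real) \<Rightarrow> 'a \<Rightarrow> bool" where
  "saddle_point f x \<longleftrightarrow> critical_point f x \<and> \<not> local_minimum f x \<and> \<not> local_maximum f x"

text \<open>The Hessian as a linear operator: the derivative of the gradient field. On a Euclidean
  space, its matrix in an orthonormal basis is the usual matrix of second partial derivatives.\<close>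

definition has_hessian :: "('a::real_inner \<Rightarrow> real) \<Rightarrow> ('a \<Rightarrow> 'a) \<Rightarrow> 'a \<Rightarrow> bool" where
  "has_hessian f H x \<longleftrightarrow>
     (\<exists>g. (\<forall>\<^sub>F y in nhds x. GDERIV f y :> g y) \<and> (g has_derivative H) (at x))"

definition eigenvalue_of :: "('a::real_vector \<Rightarrow> 'a) \<Rightarrow> real \<Rightarrow> bool" where
  "eigenvalue_of H c \<longleftrightarrow> (\<exists>v. v \<noteq> 0 \<and> H v = c *\<^sub>R v)"

definition second_order_saddle :: "('a::real_inner \<Rightarrow> real) \<Rightarrow> 'a \<Rightarrow> bool" where
  "second_order_saddle f x \<longleftrightarrow>
     critical_point f x \<and> (\<exists>H. has_hessian f H x \<and> (\<exists>c<0. eigenvalue_of H c))"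

text \<open>The objective as a function of the pair $(W_2, W_1)$. The inner product on the product type
  is the sum of the two Frobenius inner products.\<close>

definition two_layer_loss ::
    "real ^ 'n ^ 'd0 \<Rightarrow> real ^ 'n ^ 'd2 \<Rightarrow> (real ^ 'd1 ^ 'd2) \<times> (real ^ 'd0 ^ 'd1) \<Rightarrow> real" where
  "two_layer_loss X Y = (\<lambda>(W2, W1). (norm (W2 ** W1 ** X - Y))\<^sup>2 / 2)"

definition degenerate :: "(real ^ 'd1 ^ 'd2) \<times> (real ^ 'd0 ^ 'd1) \<Rightarrow> bool" where
  "degenerate = (\<lambda>(W2, W1). rank (W2 ** W1) < Min {CARD('d0), CARD('d1), CARD('d2)})"

end

theory Submission
  imports Defs
begin

text \<open>Both claims follow from one fact (\<open>psd_critical_point_global_minimum\<close>): a critical point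
  whose Hessian is positive semidefinite is a global minimum. A local minimum satisfies these second
  order conditions. A saddle point is not a local minimum, hence not a global one, so its Hessian
  form takes a negative value, and since the Hessian is self-adjoint it has a negative eigenvalue.

  To see why the fact holds, write \<open>Y = M X + N\<close> with \<open>N\<close> orthogonal to all matrices \<open>Q X\<close>. Up to a
  constant the loss at \<open>(W2, W1)\<close> is half the squared norm of \<open>E = M X - W2 W1 X\<close>. Let
  \<open>A = W1 X\<close> and \<open>B = W2\<close>. Criticality says that \<open>E\<close> and \<open>B A\<close> have orthogonal row spaces and
  orthogonal column spaces, so that the singular values of \<open>M X = B A + E\<close> are those of \<open>B A\<close>
  together with those of \<open>E\<close>. Moving \<open>W2\<close> along \<open>q x\<^sup>T\<close> and \<open>W1\<close> along \<open>y q\<^sup>T (M - W2 W1)\<close>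
  reduces semidefiniteness to the nonnegativity of a quadratic polynomial in one real variable, whose
  discriminant gives
  \<open>(x \<bullet> y)\<^sup>2 |E\<^sup>T q|\<^sup>2 \<le> |q|\<^sup>2 |A\<^sup>T x|\<^sup>2 |B y|\<^sup>2\<close> (\<open>second_order_singular_value_gap\<close>).

  If \<open>B\<close> kills some \<open>y \<noteq> 0\<close>, taking \<open>x = y\<close> forces \<open>E = 0\<close>, and nothing is left to improve. If \<open>B\<close>
  is injective, taking \<open>x = B\<^sup>T B y\<close> shows that the transpose of \<open>B A\<close> stretches each vector of the
  range of \<open>B\<close> at least as much as the transpose of \<open>E\<close> stretches any vector: the product has picked up the \<open>d1\<close> largest singular
  values of \<open>M X\<close>. By the Eckart--Young argument (\<open>low_rank_approximation_optimal\<close>) no product through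
  \<open>d1\<close> hidden units does better.\<close>

section \<open>Quadratic forms\<close>

lemma quadratic_nonneg_discriminant:
  fixes p b c :: real
  assumes "0 \<le> p" and nonneg: "\<And>s. 0 \<le> p * s\<^sup>2 - 2 * b * s + c"
  shows "b\<^sup>2 \<le> p * c"
proof (cases "p = 0")
  case True
  have "b = 0"
  proof (rule ccontr)
    assume "b \<noteq> 0"
    then show False
      using nonneg[of "(c + 1) / (2 * b)"] True by simp
  qed
  with True show ?thesis by simp
next
  case False
  have "0 \<le> p * (b * (1 / p))\<^sup>2 - 2 * b * (b * (1 / p)) + c"
    by (rule nonneg)
  also have "\<dots> = c - b\<^sup>2 / p"
    using False by (simp add: field_simps power2_eq_square)
  finally have *: "b\<^sup>2 / p \<le> c" by simp
  with False \<open>0 \<le> p\<close> * show ?thesis by (simp add: field_simps)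
qed

text \<open>The eigenvalue is the minimum of the Rayleigh quotient: subtracting it from \<open>H\<close> leaves a
  semidefinite form that vanishes at the minimizer \<open>v\<close>, and a semidefinite form can only vanish at a
  vector of its kernel.\<close>

lemma self_adjoint_negative_eigenvalue:
  fixes H :: "'a::euclidean_space \<Rightarrow> 'a"
  assumes lin: "linear H"
    and sym: "\<And>u v. H u \<bullet> v = u \<bullet> H v"
    and neg: "H u \<bullet> u < 0"
  obtains c where "c < 0" "eigenvalue_of H c"
proof -
  have u0: "u \<noteq> 0" using neg by auto
  have cont: "continuous_on (sphere 0 1) (\<lambda>v. H v \<bullet> v)"
    by (intro continuous_intros linear_continuous_on linear_conv_bounded_linear[THEN iffD1] lin)
  have "sphere (0::'a) 1 \<noteq> {}" by simp
  then obtain v where v: "v \<in> sphere 0 1" and vmin: "\<And>w. w \<in> sphere 0 1 \<Longrightarrow> H v \<bullet> v \<le> H w \<bullet> w"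
    using continuous_attains_inf[OF compact_sphere _ cont] by blast
  define c where "c = H v \<bullet> v"
  have bound: "c * (norm w)\<^sup>2 \<le> H w \<bullet> w" for w
  proof (cases "w = 0")
    case False
    have "c \<le> H ((1 / norm w) *\<^sub>R w) \<bullet> ((1 / norm w) *\<^sub>R w)"
      unfolding c_def using False by (intro vmin) simp
    also have "\<dots> = (H w \<bullet> w) / (norm w)\<^sup>2"
      by (simp add: linear_scale[OF lin] power2_eq_square)
    finally show ?thesis using False by (simp add: field_simps)
  qed (simp add: linear_0[OF lin])
  have "c * (norm u)\<^sup>2 < 0" using bound[of u] neg by simp
  then have "c < 0" using u0 by (simp add: mult_less_0_iff)
  define r where "r = H v - c *\<^sub>R v"
  have vv: "v \<bullet> v = 1" using v by (simp add: norm_eq_1)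
  \<comment> \<open>At \<open>v + s r\<close> the shifted form has no constant term and the linear term \<open>2 s |r|\<^sup>2\<close>, so it would
    take negative values for small \<open>s < 0\<close> if \<open>r \<noteq> 0\<close>.\<close>
  have "0 \<le> (H r \<bullet> r - c * (r \<bullet> r)) * s\<^sup>2 - 2 * (- (r \<bullet> r)) * s + 0" for s
  proof -
    have "0 \<le> H (v + s *\<^sub>R r) \<bullet> (v + s *\<^sub>R r) - c * ((v + s *\<^sub>R r) \<bullet> (v + s *\<^sub>R r))"
      using bound[of "v + s *\<^sub>R r"] by (simp add: power2_norm_eq_inner)
    also have "H (v + s *\<^sub>R r) \<bullet> (v + s *\<^sub>R r) = c + 2 * s * (H v \<bullet> r) + s\<^sup>2 * (H r \<bullet> r)"
      using sym[of r v]
      by (simp add: linear_add[OF lin] linear_scale[OF lin] inner_add_left inner_add_right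
          c_def inner_commute[of r "H v"] power2_eq_square algebra_simps)
    also have "(v + s *\<^sub>R r) \<bullet> (v + s *\<^sub>R r) = 1 + 2 * s * (v \<bullet> r) + s\<^sup>2 * (r \<bullet> r)"
      by (simp add: inner_add_left inner_add_right vv inner_commute[of r v] power2_eq_square algebra_simps)
    also have "c + 2 * s * (H v \<bullet> r) + s\<^sup>2 * (H r \<bullet> r)
        - c * (1 + 2 * s * (v \<bullet> r) + s\<^sup>2 * (r \<bullet> r))
        = (H r \<bullet> r - c * (r \<bullet> r)) * s\<^sup>2 + 2 * s * (H v \<bullet> r - c * (v \<bullet> r))"
      by (simp add: algebra_simps)
    also have "H v \<bullet> r - c * (v \<bullet> r) = r \<bullet> r"
      using inner_diff_left[of "H v" "c *\<^sub>R v" r] by (simp add: r_def[symmetric])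
    finally show ?thesis by (simp add: algebra_simps)
  qed
  moreover have "0 \<le> H r \<bullet> r - c * (r \<bullet> r)"
    using bound[of r] by (simp add: power2_norm_eq_inner)
  ultimately have "r = 0"
    using quadratic_nonneg_discriminant[of "H r \<bullet> r - c * (r \<bullet> r)" "- (r \<bullet> r)" 0] by simp
  then have "H v = c *\<^sub>R v" by (simp add: r_def)
  moreover have "v \<noteq> 0" using vv by auto
  ultimately show ?thesis
    using that \<open>c < 0\<close> by (auto simp: eigenvalue_of_def)
qed

section \<open>Frobenius inner products and rank one matrices\<close>

lemma bounded_bilinear_matrix_mult:
  "bounded_bilinear ((**) :: real ^ 'n ^ 'm \<Rightarrow> real ^ 'p ^ 'n \<Rightarrow> real ^ 'p ^ 'm)"
  unfolding bilinear_conv_bounded_bilinear[symmetric] bilinear_def linear_iff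
  by (simp add: matrix_add_ldistrib scalar_matrix_assoc matrix_scalar_ac)
    (simp add: matrix_matrix_mult_def vec_eq_iff sum.distrib distrib_right)

interpretation matrix_mult: bounded_bilinear
  "(**) :: real ^ 'n ^ 'm \<Rightarrow> real ^ 'p ^ 'n \<Rightarrow> real ^ 'p ^ 'm"
  by (rule bounded_bilinear_matrix_mult)

lemma inner_matrix_mult_left_factor:
  fixes U :: "real ^ 'n ^ 'm"
  shows "(U ** A) \<bullet> R = U \<bullet> (R ** transpose A)"
proof -
  have "(U ** A) \<bullet> R = (\<Sum>i\<in>UNIV. \<Sum>k\<in>UNIV. \<Sum>j\<in>UNIV. U$i$j * A$j$k * R$i$k)"
    by (simp add: inner_vec_def matrix_matrix_mult_def sum_distrib_right)
  also have "\<dots> = (\<Sum>i\<in>UNIV. \<Sum>j\<in>UNIV. \<Sum>k\<in>UNIV. U$i$j * A$j$k * R$i$k)"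
    by (intro sum.cong refl sum.swap)
  also have "\<dots> = U \<bullet> (R ** transpose A)"
    by (simp add: inner_vec_def matrix_matrix_mult_def transpose_def sum_distrib_left mult_ac)
  finally show ?thesis .
qed

lemma inner_transpose:
  fixes A B :: "real ^ 'n ^ 'm"
  shows "transpose A \<bullet> transpose B = A \<bullet> B"
  by (simp add: inner_vec_def transpose_def) (rule sum.swap)

lemma inner_matrix_mult_right_factor:
  fixes U :: "real ^ 'p ^ 'n"
  shows "(B ** U) \<bullet> R = U \<bullet> (transpose B ** R)"
  using inner_matrix_mult_left_factor[of "transpose U" "transpose B" "transpose R"]
    inner_transpose[of "B ** U" R] inner_transpose[of U "transpose B ** R"]
  by (simp add: matrix_transpose_mul)

definition outer :: "real ^ 'm \<Rightarrow> real ^ 'n \<Rightarrow> real ^ 'n ^ 'm"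
  where "outer a b = (\<chi> i j. a $ i * b $ j)"

lemma outer_matrix_mult: "outer a b ** M = outer a (b v* M)"
  by (simp add: outer_def vec_eq_iff matrix_matrix_mult_def vector_matrix_mult_def
      sum_distrib_left mult_ac)

lemma matrix_mult_outer: "M ** outer a b = outer (M *v a) b"
  by (simp add: outer_def vec_eq_iff matrix_matrix_mult_def matrix_vector_mult_def
      sum_distrib_left mult_ac)

lemma inner_outer: "M \<bullet> outer a b = a \<bullet> (M *v b)"
  by (simp add: inner_vec_def outer_def matrix_vector_mult_def sum_distrib_left mult_ac)

lemma outer_mult_vector: "outer a b *v x = (b \<bullet> x) *\<^sub>R a"
  by (simp add: inner_vec_def outer_def matrix_vector_mult_def vec_eq_iff sum_distrib_left mult_ac)

lemma outer_scaleR_left: "outer (s *\<^sub>R a) b = s *\<^sub>R outer a b"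
  by (simp add: outer_def vec_eq_iff)

section \<open>Best approximation by matrices of bounded rank\<close>

lemma parseval_orthonormal_basis:
  fixes x :: "'a::euclidean_space"
  assumes "pairwise orthogonal Q" "\<And>q. q \<in> Q \<Longrightarrow> norm q = 1" "finite Q" "span Q = UNIV"
  shows "(\<Sum>q\<in>Q. (q \<bullet> x)\<^sup>2) = (norm x)\<^sup>2"
proof -
  have "(norm x)\<^sup>2 = x \<bullet> (\<Sum>q\<in>Q. (x \<bullet> q) *\<^sub>R q)"
    by (subst orthonormal_basis_expand) (use assms in \<open>auto simp: power2_norm_eq_inner\<close>)
  then show ?thesis
    by (simp add: inner_sum_right power2_eq_square inner_commute)
qed

lemma frobenius_norm_orthonormal_basis:
  fixes M :: "real ^ 'n ^ 'm"
  assumes "pairwise orthogonal Q" "\<And>q. q \<in> Q \<Longrightarrow> norm q = 1" "finite Q" "span Q = UNIV"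
  shows "(\<Sum>q\<in>Q. (norm (q v* M))\<^sup>2) = (norm M)\<^sup>2"
proof -
  have "(\<Sum>q\<in>Q. (norm (q v* M))\<^sup>2) = (\<Sum>q\<in>Q. \<Sum>j\<in>UNIV. (q \<bullet> column j M)\<^sup>2)"
    by (simp only: power2_norm_eq_inner)
      (simp add: inner_vec_def vector_matrix_mult_def column_def power2_eq_square mult_ac)
  also have "\<dots> = (\<Sum>j\<in>UNIV. (norm (column j M))\<^sup>2)"
    by (subst sum.swap) (simp add: parseval_orthonormal_basis[OF assms])
  also have "\<dots> = (\<Sum>j\<in>UNIV. \<Sum>i\<in>UNIV. (M $ i $ j)\<^sup>2)"
    by (simp only: power2_norm_eq_inner) (simp add: inner_vec_def column_def power2_eq_square)
  also have "\<dots> = (norm M)\<^sup>2"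
    by (subst sum.swap) (simp add: norm_matrix_frobenius sum_nonneg)
  finally show ?thesis .
qed

text \<open>A form of the Eckart--Young theorem without singular value decompositions. The hypothesis
  on the norms separates the singular values of \<open>E\<close> from those of \<open>B A\<close> by a threshold \<open>\<mu>\<close>, the
  largest squared singular value of \<open>E\<close>. Split the whole space into the range of the competitor \<open>V\<close>,
  with orthonormal basis \<open>K\<close>, and its complement, with orthonormal basis \<open>L\<close>. The competitor can at
  best remove the part of \<open>B A + E\<close> seen from \<open>K\<close>, so it suffices that \<open>B A\<close> seen from \<open>L\<close> outweighs
  \<open>E\<close> seen from \<open>K\<close>. With \<open>w q\<close> the squared length of the projection of \<open>q\<close> to the range of \<open>B\<close>,
  the former is at least \<open>\<mu>\<close> times the sum of \<open>w\<close> over \<open>L\<close>, the latter at most \<open>\<mu>\<close> times the sum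
  of \<open>1 - w\<close> over \<open>K\<close>. These sums compare as required because the sum of \<open>w\<close> over \<open>K\<close> and \<open>L\<close> is the
  trace of the projection.
  This trace is the rank of \<open>B\<close>, which is at least the cardinality of \<open>K\<close>.\<close>

lemma low_rank_approximation_optimal:
  fixes B V :: "real ^ 'r ^ 'm" and A C :: "real ^ 'n ^ 'r" and E :: "real ^ 'n ^ 'm"
  assumes inj: "inj ((*v) B)"
    and BE: "transpose B ** E = 0"
    and EA: "E ** transpose A = 0"
    and gap: "\<And>q y. (norm (B *v y))\<^sup>2 * (norm (q v* E))\<^sup>2
                \<le> (norm q)\<^sup>2 * (norm ((B *v y) v* (B ** A)))\<^sup>2"
  shows "norm E \<le> norm (V ** C - (B ** A + E))"
proof -
  define \<mu> where "\<mu> = (onorm (\<lambda>q. q v* E))\<^sup>2"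
  have "(\<lambda>q. q v* E) = (*v) (transpose E)"
    by (simp add: fun_eq_iff)
  then have bl: "bounded_linear (\<lambda>q. q v* E)" by simp
  have \<mu>0: "0 \<le> \<mu>" by (simp add: \<mu>_def)
  have upper: "(norm (q v* E))\<^sup>2 \<le> \<mu> * (norm q)\<^sup>2" for q
    using power_mono[OF onorm[OF bl, of q], of 2] by (simp add: \<mu>_def power_mult_distrib)
  have lower: "\<mu> * (norm (B *v y))\<^sup>2 \<le> (norm ((B *v y) v* (B ** A)))\<^sup>2" for y
  proof (cases "B *v y = 0")
    case False
    let ?c = "norm ((B *v y) v* (B ** A)) / norm (B *v y)"
    have "norm (q v* E) \<le> ?c * norm q" for q
    proof -
      have "(norm (B *v y) * norm (q v* E))\<^sup>2 \<le> (norm q * norm ((B *v y) v* (B ** A)))\<^sup>2"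
        using gap[of y q] by (simp add: power_mult_distrib)
      then have "norm (B *v y) * norm (q v* E) \<le> norm q * norm ((B *v y) v* (B ** A))"
        by (rule power2_le_imp_le) simp
      then show ?thesis using False by (simp add: field_simps)
    qed
    then have "onorm (\<lambda>q. q v* E) \<le> ?c" by (intro onorm_bound) simp_all
    then have "\<mu> \<le> ?c\<^sup>2" unfolding \<mu>_def by (intro power_mono onorm_pos_le bl)
    then show ?thesis using False by (simp add: field_simps power_divide)
  qed simp
  obtain F where F: "F \<subseteq> range ((*v) B)" "pairwise orthogonal F" "\<And>f. f \<in> F \<Longrightarrow> norm f = 1"
      "independent F" "card F = dim (range ((*v) B))" "span F = range ((*v) B)"
    by (metis orthonormal_basis_subspace linear_subspace_image matrix_vector_mul_linear subspace_UNIV)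
  have finF: "finite F" by (rule independent_imp_finite) fact
  have cardF: "card F = CARD('r)"
    using inj F(5) by (simp add: full_rank_injective[symmetric] rank_dim_range)
  define \<pi> where "\<pi> q = (\<Sum>f\<in>F. (f \<bullet> q) *\<^sub>R f)" for q
  define w where "w q = (\<Sum>f\<in>F. (f \<bullet> q)\<^sup>2)" for q
  have \<pi>_in: "\<exists>y. \<pi> q = B *v y" for q
  proof -
    have "\<pi> q \<in> span F" unfolding \<pi>_def by (intro span_sum span_scale span_base)
    then show ?thesis using F(6) by auto
  qed
  have norm_\<pi>: "(norm (\<pi> q))\<^sup>2 = w q" for q
  proof -
    have "(norm (\<pi> q))\<^sup>2 = (\<Sum>f\<in>F. (norm ((f \<bullet> q) *\<^sub>R f))\<^sup>2)"
      unfolding \<pi>_def using F(2) finF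
      by (intro norm_sum_Pythagorean) (auto simp: pairwise_def orthogonal_def)
    then show ?thesis by (simp add: w_def F(3) power_mult_distrib)
  qed
  have q\<pi>: "q \<bullet> \<pi> q = w q" for q
    by (simp add: \<pi>_def w_def inner_sum_right power2_eq_square inner_commute)
  have orth_F: "f \<bullet> (q - \<pi> q) = 0" if "f \<in> F" for f q
  proof -
    have "f \<bullet> \<pi> q = (\<Sum>g\<in>F. if g = f then f \<bullet> q else 0)"
      unfolding \<pi>_def inner_sum_right
    proof (rule sum.cong)
      fix g assume "g \<in> F"
      then show "f \<bullet> (g \<bullet> q) *\<^sub>R g = (if g = f then f \<bullet> q else 0)"
        using F(2) F(3)[OF that] that
        by (auto simp: pairwise_def orthogonal_def norm_eq_1)
    qed simp
    then show ?thesis using that finF by (simp add: inner_diff_right)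
  qed
  have B_orth: "(q - \<pi> q) v* B = 0" for q
  proof -
    have "(B *v x) \<bullet> (q - \<pi> q) = 0" for x
    proof -
      have "B *v x \<in> span F" using F(6) by auto
      then show ?thesis
      proof (induction rule: span_induct)
        case base then show ?case by (simp add: subspace_def inner_simps)
      next
        case (step f) then show ?case by (rule orth_F)
      qed
    qed
    then have "((q - \<pi> q) v* B) \<bullet> x = 0" for x
      unfolding dot_lmul_matrix by (metis inner_commute)
    then show ?thesis by (metis inner_eq_zero_iff)
  qed
  have E_ker: "\<pi> q v* E = 0" for q
  proof -
    obtain y where "\<pi> q = B *v y" using \<pi>_in by blast
    then have "\<pi> q v* E = (y v* transpose B) v* E" by simp
    also have "\<dots> = 0" by (simp only: vector_matrix_mul_assoc BE) simp
    finally show ?thesis .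
  qed
  have E_le: "(norm (q v* E))\<^sup>2 \<le> \<mu> * ((norm q)\<^sup>2 - w q)" for q
  proof -
    have "q v* E = (q - \<pi> q) v* E" by (simp add: vector_matrix_mult_diff_distrib E_ker)
    then have "(norm (q v* E))\<^sup>2 \<le> \<mu> * (norm (q - \<pi> q))\<^sup>2" using upper by simp
    also have "(norm (q - \<pi> q))\<^sup>2 = (norm q)\<^sup>2 - w q"
      using q\<pi>[of q] norm_\<pi>[of q]
      by (simp add: power2_norm_eq_inner inner_simps inner_commute)
    finally show ?thesis .
  qed
  have Z_ge: "\<mu> * w q \<le> (norm (q v* (B ** A)))\<^sup>2" for q
  proof -
    have "(q - \<pi> q) v* (B ** A) = 0"
      by (simp add: vector_matrix_mul_assoc[symmetric] B_orth)
    then have "q v* (B ** A) = \<pi> q v* (B ** A)" by (simp add: vector_matrix_mult_diff_distrib)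
    then show ?thesis using \<pi>_in[of q] lower norm_\<pi>[of q] by metis
  qed
  have split: "(norm (q v* (B ** A + E)))\<^sup>2 = (norm (q v* (B ** A)))\<^sup>2 + (norm (q v* E))\<^sup>2" for q
  proof -
    have "(q v* (B ** A)) \<bullet> (q v* E) = ((q v* B) v* A) \<bullet> (q v* E)"
      by (simp add: vector_matrix_mul_assoc)
    also have "\<dots> = (q v* B) \<bullet> ((q v* E) v* transpose A)"
      by (simp add: dot_lmul_matrix)
    also have "\<dots> = 0"
      by (simp only: vector_matrix_mul_assoc EA) simp
    finally show ?thesis
      by (simp add: vector_matrix_mult_add_rdistrib power2_norm_eq_inner inner_simps inner_commute)
  qed
  define T where "T = range ((*v) V)"
  define T' where "T' = {y. \<forall>x\<in>T. orthogonal x y}"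
  have T: "subspace T" unfolding T_def
    by (intro linear_subspace_image matrix_vector_mul_linear subspace_UNIV)
  have T': "subspace T'" unfolding T'_def by (rule subspace_orthogonal_to_vectors)
  obtain K where K: "K \<subseteq> T" "pairwise orthogonal K" "\<And>x. x \<in> K \<Longrightarrow> norm x = 1"
      "independent K" "card K = dim T" "span K = T"
    using orthonormal_basis_subspace[OF T] by metis
  obtain L where L: "L \<subseteq> T'" "pairwise orthogonal L" "\<And>x. x \<in> L \<Longrightarrow> norm x = 1"
      "independent L" "card L = dim T'" "span L = T'"
    using orthonormal_basis_subspace[OF T'] by metis
  have fin: "finite K" "finite L" using K(4) L(4) independent_imp_finite by auto
  have orthKL: "x \<bullet> y = 0" if "x \<in> K" "y \<in> L" for x y
    using that K(1) L(1) by (auto simp: T'_def orthogonal_def)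
  have disj: "K \<inter> L = {}"
    using orthKL K(3) by (metis disjoint_iff norm_eq_1 zero_neq_one)
  have Q: "pairwise orthogonal (K \<union> L)" "\<And>q. q \<in> K \<union> L \<Longrightarrow> norm q = 1" "finite (K \<union> L)"
    using K(2,3) L(2,3) fin orthKL by (auto simp: pairwise_def orthogonal_def)
      (metis inner_commute)
  have spanQ: "span (K \<union> L) = UNIV"
  proof -
    have "x \<in> span (K \<union> L)" for x
    proof -
      obtain y z where yz: "y \<in> span T" "\<And>w. w \<in> span T \<Longrightarrow> orthogonal z w" "x = y + z"
        using orthogonal_subspace_decomp_exists by blast
      have "y \<in> span K" using yz(1) T K(6) by (metis span_eq_iff)
      moreover have "z \<in> span L"
        using yz(2) L(6) by (auto simp: T'_def orthogonal_commute span_base)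
      ultimately show ?thesis
        unfolding yz(3) by (meson Un_upper1 Un_upper2 span_add span_mono subsetD)
    qed
    then show ?thesis by auto
  qed
  have parseval: "(\<Sum>q\<in>K \<union> L. (q \<bullet> f)\<^sup>2) = (norm f)\<^sup>2" for f
    by (rule parseval_orthonormal_basis) (use Q spanQ in auto)
  have frobenius: "(\<Sum>q\<in>K \<union> L. (norm (q v* G))\<^sup>2) = (norm G)\<^sup>2" for G :: "real ^ 'n ^ 'm"
    by (rule frobenius_norm_orthonormal_basis) (use Q spanQ in auto)
  have cardK: "card K \<le> CARD('r)"
    using K(5) rank_bound[of V] by (simp add: T_def rank_dim_range)
  have V0: "q v* V = 0" if "q \<in> L" for q
  proof -
    have "(q v* V) \<bullet> z = 0" for z
      using that L(1) unfolding dot_lmul_matrix T'_def T_def orthogonal_def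
      by (auto simp: inner_commute[of q])
    then show ?thesis by (metis inner_eq_zero_iff)
  qed
  \<comment> \<open>The trace of the projection to the range of \<open>B\<close>, computed in the basis \<open>K \<union> L\<close>.\<close>
  have sumw: "(\<Sum>q\<in>K. w q) + (\<Sum>q\<in>L. w q) = CARD('r)"
  proof -
    have "(\<Sum>q\<in>K. w q) + (\<Sum>q\<in>L. w q) = (\<Sum>q\<in>K \<union> L. w q)"
      by (rule sum.union_disjoint[symmetric]) (use fin disj in auto)
    also have "\<dots> = (\<Sum>f\<in>F. \<Sum>q\<in>K \<union> L. (q \<bullet> f)\<^sup>2)"
      unfolding w_def by (subst sum.swap) (simp add: inner_commute)
    also have "\<dots> = (\<Sum>f\<in>F. 1)"
      using F(3) by (intro sum.cong) (simp_all add: parseval)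
    finally show ?thesis by (simp add: cardF)
  qed
  have "(\<Sum>q\<in>K. (norm (q v* E))\<^sup>2) \<le> (\<Sum>q\<in>K. \<mu> * (1 - w q))"
    using E_le K(3) by (intro sum_mono) (metis one_power2)
  also have "\<dots> = \<mu> * (card K - (\<Sum>q\<in>K. w q))"
    by (simp add: sum_distrib_left[symmetric] sum_subtractf)
  also have "\<dots> \<le> \<mu> * (\<Sum>q\<in>L. w q)"
    using sumw cardK \<mu>0 by (intro mult_left_mono) auto
  also have "\<dots> \<le> (\<Sum>q\<in>L. (norm (q v* (B ** A)))\<^sup>2)"
    unfolding sum_distrib_left by (intro sum_mono Z_ge)
  finally have key: "(\<Sum>q\<in>K. (norm (q v* E))\<^sup>2) \<le> (\<Sum>q\<in>L. (norm (q v* (B ** A)))\<^sup>2)" .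
  let ?D = "V ** C - (B ** A + E)"
  have "(norm E)\<^sup>2 = (\<Sum>q\<in>K. (norm (q v* E))\<^sup>2) + (\<Sum>q\<in>L. (norm (q v* E))\<^sup>2)"
    using frobenius[of E] fin disj
    by (simp add: sum.union_disjoint)
  also have "\<dots> \<le> (\<Sum>q\<in>L. (norm (q v* (B ** A + E)))\<^sup>2)"
    using key by (simp add: split sum.distrib)
  also have "\<dots> = (\<Sum>q\<in>L. (norm (q v* ?D))\<^sup>2)"
  proof (intro sum.cong refl)
    fix q assume "q \<in> L"
    then have "q v* (V ** C) = 0" using V0 by (simp add: vector_matrix_mul_assoc[symmetric])
    then show "(norm (q v* (B ** A + E)))\<^sup>2 = (norm (q v* ?D))\<^sup>2"
      by (simp add: vector_matrix_mult_diff_rdistrib norm_minus_commute)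
  qed
  also have "\<dots> \<le> (\<Sum>q\<in>K \<union> L. (norm (q v* ?D))\<^sup>2)"
    using fin by (intro sum_mono2) auto
  also have "\<dots> = (norm ?D)\<^sup>2"
    by (rule frobenius)
  finally show ?thesis by (rule power2_le_imp_le) simp
qed

section \<open>The second variation along rank one directions\<close>

text \<open>The form in \<open>psd\<close> is the Hessian form of the loss with the residual replaced by \<open>- D X\<close>. It is
  tested on \<open>U2 = s q x\<^sup>T\<close> and \<open>U1 = y (D\<^sup>T q)\<^sup>T\<close>, for which
  \<open>U1 X = y e\<^sup>T\<close> with \<open>e = (D X)\<^sup>T q\<close>: the product \<open>U2 U1 X\<close> points towards the error \<open>D X\<close>. The choice of \<open>U1\<close>
  through \<open>D\<close> keeps \<open>e\<close> in the row space of \<open>X\<close>, whatever the rank of \<open>X\<close>. The cross term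
  of the square vanishes by \<open>EA\<close>, which leaves a quadratic polynomial in \<open>s\<close>.\<close>

lemma second_order_singular_value_gap:
  fixes B :: "real ^ 'r ^ 'm" and W :: "real ^ 'd ^ 'r" and D :: "real ^ 'd ^ 'm"
    and X :: "real ^ 'n ^ 'd"
  assumes EA: "(D ** X) ** transpose (W ** X) = 0"
    and psd: "\<And>U2 U1. 0 \<le> (norm (U2 ** (W ** X) + B ** (U1 ** X)))\<^sup>2
                - 2 * ((D ** X) \<bullet> (U2 ** U1 ** X))"
  shows "(x \<bullet> y)\<^sup>2 * (norm (q v* (D ** X)))\<^sup>2
           \<le> (norm q)\<^sup>2 * (norm (x v* (W ** X)))\<^sup>2 * (norm (B *v y))\<^sup>2"
proof -
  define a where "a = x v* (W ** X)"
  define e where "e = q v* (D ** X)"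
  have ae: "a \<bullet> e = 0"
  proof -
    have "a \<bullet> e = x \<bullet> (e v* transpose (W ** X))"
      by (simp add: a_def dot_lmul_matrix)
    also have "\<dots> = 0"
      unfolding e_def by (simp only: vector_matrix_mul_assoc EA) simp
    finally show ?thesis .
  qed
  have "0 \<le> ((norm q)\<^sup>2 * (norm a)\<^sup>2) * s\<^sup>2 - 2 * ((x \<bullet> y) * (norm e)\<^sup>2) * s
            + (norm (B *v y))\<^sup>2 * (norm e)\<^sup>2" for s
  proof -
    let ?U2 = "s *\<^sub>R outer q x" and ?U1 = "outer y (q v* D)"
    have U2: "?U2 ** (W ** X) = s *\<^sub>R outer q a"
      by (simp add: matrix_mult.scaleR_left outer_matrix_mult a_def)
    have U1: "?U1 ** X = outer y e"
      by (simp add: outer_matrix_mult e_def vector_matrix_mul_assoc)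
    have U21: "?U2 ** ?U1 ** X = (s * (x \<bullet> y)) *\<^sub>R outer q e"
      unfolding matrix_mul_assoc[symmetric] U1
      by (simp add: matrix_mult_outer scaleR_matrix_vector_assoc[symmetric] outer_mult_vector
          outer_scaleR_left)
    have "(norm (?U2 ** (W ** X) + B ** (?U1 ** X)))\<^sup>2
        = (norm q)\<^sup>2 * (norm a)\<^sup>2 * s\<^sup>2 + (norm (B *v y))\<^sup>2 * (norm e)\<^sup>2"
      unfolding U1 U2 matrix_mult_outer power2_norm_eq_inner
      by (simp add: inner_simps inner_outer scaleR_matrix_vector_assoc[symmetric] outer_mult_vector
          matrix_vector_mult_add_rdistrib ae inner_commute[of e a] power2_eq_square)
    moreover have "(D ** X) \<bullet> (?U2 ** ?U1 ** X) = s * (x \<bullet> y) * (norm e)\<^sup>2"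
      unfolding U21 by (simp add: inner_outer e_def dot_lmul_matrix[symmetric] power2_norm_eq_inner)
    ultimately show ?thesis using psd[of ?U2 ?U1] by (simp add: algebra_simps)
  qed
  from quadratic_nonneg_discriminant[OF _ this]
  have *: "((x \<bullet> y) * (norm e)\<^sup>2)\<^sup>2
      \<le> ((norm q)\<^sup>2 * (norm a)\<^sup>2) * ((norm (B *v y))\<^sup>2 * (norm e)\<^sup>2)" by simp
  show ?thesis
  proof (cases "e = 0")
    case False
    have "((x \<bullet> y)\<^sup>2 * (norm e)\<^sup>2) * (norm e)\<^sup>2
      \<le> ((norm q)\<^sup>2 * (norm a)\<^sup>2 * (norm (B *v y))\<^sup>2) * (norm e)\<^sup>2"
      using * by (simp add: power2_eq_square mult_ac)
    then show ?thesis using False by (simp add: a_def e_def)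
  qed (simp add: e_def)
qed


section \<open>Gradient and Hessian of the loss\<close>

definition residual ::
    "real ^ 'n ^ 'd0 \<Rightarrow> real ^ 'n ^ 'd2 \<Rightarrow> (real ^ 'd1 ^ 'd2) \<times> (real ^ 'd0 ^ 'd1) \<Rightarrow> real ^ 'n ^ 'd2" where
  "residual X Y W = fst W ** snd W ** X - Y"

definition residual_derivative ::
    "real ^ 'n ^ 'd0 \<Rightarrow> (real ^ 'd1 ^ 'd2) \<times> (real ^ 'd0 ^ 'd1) \<Rightarrow>
     (real ^ 'd1 ^ 'd2) \<times> (real ^ 'd0 ^ 'd1) \<Rightarrow> real ^ 'n ^ 'd2" where
  "residual_derivative X W U = fst U ** (snd W ** X) + fst W ** (snd U ** X)"

definition loss_gradient ::
    "real ^ 'n ^ 'd0 \<Rightarrow> real ^ 'n ^ 'd2 \<Rightarrow> (real ^ 'd1 ^ 'd2) \<times> (real ^ 'd0 ^ 'd1) \<Rightarrow>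
     (real ^ 'd1 ^ 'd2) \<times> (real ^ 'd0 ^ 'd1)" where
  "loss_gradient X Y W =
     (residual X Y W ** transpose (snd W ** X),
      transpose (fst W) ** (residual X Y W ** transpose X))"

definition loss_hessian ::
    "real ^ 'n ^ 'd0 \<Rightarrow> real ^ 'n ^ 'd2 \<Rightarrow> (real ^ 'd1 ^ 'd2) \<times> (real ^ 'd0 ^ 'd1) \<Rightarrow>
     (real ^ 'd1 ^ 'd2) \<times> (real ^ 'd0 ^ 'd1) \<Rightarrow> (real ^ 'd1 ^ 'd2) \<times> (real ^ 'd0 ^ 'd1)" where
  "loss_hessian X Y W U =
     (residual_derivative X W U ** transpose (snd W ** X)
        + residual X Y W ** transpose (snd U ** X),
      transpose (fst U) ** (residual X Y W ** transpose X)
        + transpose (fst W) ** (residual_derivative X W U ** transpose X))"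

lemma two_layer_loss_residual: "two_layer_loss X Y W = (residual X Y W \<bullet> residual X Y W) / 2"
  by (simp add: two_layer_loss_def residual_def split_beta power2_norm_eq_inner)

lemma bounded_linear_transpose: "bounded_linear (transpose :: real ^ 'n ^ 'm \<Rightarrow> real ^ 'm ^ 'n)"
  unfolding linear_conv_bounded_linear[symmetric] linear_iff
  by (simp add: transpose_def vec_eq_iff)

lemma has_derivative_residual:
  "(residual X Y has_derivative residual_derivative X W) (at W)"
  unfolding residual_def[abs_def] residual_derivative_def[abs_def]
  by (auto intro!: derivative_eq_intros matrix_mult.FDERIV
      simp: fun_eq_iff matrix_mult.add_left matrix_mul_assoc)

lemma inner_loss_gradient:
  "loss_gradient X Y W \<bullet> U = residual X Y W \<bullet> residual_derivative X W U"
  unfolding loss_gradient_def residual_derivative_def inner_prod_def inner_add_right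
  using inner_matrix_mult_left_factor[of "fst U" "snd W ** X" "residual X Y W"]
    inner_matrix_mult_right_factor[of "fst W" "snd U ** X" "residual X Y W"]
    inner_matrix_mult_left_factor[of "snd U" X "transpose (fst W) ** residual X Y W"]
  by (simp add: inner_commute matrix_mul_assoc)

lemma gderiv_two_layer_loss: "GDERIV (two_layer_loss X Y) W :> loss_gradient X Y W"
proof -
  have "((\<lambda>V. residual X Y V \<bullet> residual X Y V) has_derivative
      (\<lambda>U. residual X Y W \<bullet> residual_derivative X W U + residual_derivative X W U \<bullet> residual X Y W))
      (at W)"
    by (intro has_derivative_inner has_derivative_residual)
  then have "(two_layer_loss X Y has_derivative
      (\<lambda>U. (residual X Y W \<bullet> residual_derivative X W U
              + residual_derivative X W U \<bullet> residual X Y W) / 2)) (at W)"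
    unfolding two_layer_loss_residual[abs_def]
    by (rule bounded_linear.has_derivative[OF bounded_linear_divide])
  moreover have "(residual X Y W \<bullet> residual_derivative X W U
      + residual_derivative X W U \<bullet> residual X Y W) / 2 = U \<bullet> loss_gradient X Y W" for U
    by (simp add: inner_commute[of U] inner_loss_gradient inner_commute[of _ "residual X Y W"])
  ultimately show ?thesis by (simp add: gderiv_def)
qed

lemma critical_point_iff_gradient:
  "critical_point (two_layer_loss X Y) W \<longleftrightarrow> loss_gradient X Y W = 0"
proof
  assume "critical_point (two_layer_loss X Y) W"
  then have "(\<lambda>h. h \<bullet> 0) = (\<lambda>h. h \<bullet> loss_gradient X Y W)"
    using gderiv_two_layer_loss[of X Y W] unfolding critical_point_def gderiv_def
    by (rule has_derivative_unique)
  then show "loss_gradient X Y W = 0"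
    by (metis inner_eq_zero_iff inner_zero_right)
next
  assume "loss_gradient X Y W = 0"
  then show "critical_point (two_layer_loss X Y) W"
    using gderiv_two_layer_loss[of X Y W] by (simp add: critical_point_def)
qed

lemma has_derivative_loss_gradient:
  "(loss_gradient X Y has_derivative loss_hessian X Y W) (at W)"
proof -
  have first_layer: "((\<lambda>V. snd V ** X) has_derivative (\<lambda>U. snd U ** X)) (at W)"
    by (intro bounded_linear.has_derivative[OF matrix_mult.bounded_linear_left] derivative_intros)
  show ?thesis
    unfolding loss_gradient_def[abs_def] loss_hessian_def[abs_def]
    by (rule derivative_eq_intros matrix_mult.FDERIV has_derivative_residual first_layer
        bounded_linear.has_derivative[OF bounded_linear_transpose] refl)+
      (simp add: fun_eq_iff add.commute)
qed

lemma has_hessian_two_layer_loss: "has_hessian (two_layer_loss X Y) (loss_hessian X Y W) W"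
  unfolding has_hessian_def
  by (intro exI[of _ "loss_gradient X Y"] conjI always_eventually allI
      gderiv_two_layer_loss has_derivative_loss_gradient)

lemma inner_loss_hessian:
  "loss_hessian X Y W U \<bullet> V = residual_derivative X W U \<bullet> residual_derivative X W V
     + residual X Y W \<bullet> (fst U ** snd V ** X + fst V ** snd U ** X)"
proof -
  let ?R = "residual X Y W" and ?D = "residual_derivative X W U"
  have "fst V \<bullet> (?D ** transpose (snd W ** X)) = ?D \<bullet> (fst V ** (snd W ** X))"
    "fst V \<bullet> (?R ** transpose (snd U ** X)) = ?R \<bullet> (fst V ** (snd U ** X))"
    by (simp_all only: inner_matrix_mult_left_factor[symmetric] inner_commute)
  moreover have "snd V \<bullet> (transpose (fst U) ** (?R ** transpose X)) = ?R \<bullet> (fst U ** snd V ** X)"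
    "snd V \<bullet> (transpose (fst W) ** (?D ** transpose X)) = ?D \<bullet> (fst W ** (snd V ** X))"
    by (simp_all only: inner_matrix_mult_left_factor[symmetric]
        inner_matrix_mult_right_factor[symmetric] matrix_mul_assoc inner_commute)
  ultimately show ?thesis
    by (simp add: loss_hessian_def residual_derivative_def[of X W V] inner_prod_def inner_add_left
        inner_add_right inner_commute[of _ "fst V"] inner_commute[of _ "snd V"] matrix_mul_assoc)
qed

text \<open>Along a line through \<open>W\<close> the residual is quadratic in the parameter \<open>t\<close>, so the loss is a
  polynomial of degree at most four, without linear term by criticality. Dividing its increment by \<open>t\<^sup>2\<close> and letting \<open>t\<close>
  tend to 0 leaves half the Hessian form.\<close>

lemma local_minimum_second_order_conditions:
  assumes "local_minimum (two_layer_loss X Y) W"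
  shows "loss_gradient X Y W = 0" and "0 \<le> loss_hessian X Y W U \<bullet> U"
proof -
  let ?f = "two_layer_loss X Y"
  have ev: "\<forall>\<^sub>F V in nhds W. ?f W \<le> ?f V"
    using assms by (simp add: local_minimum_def)
  have "(\<lambda>h. h \<bullet> loss_gradient X Y W) = (\<lambda>h. 0)"
    using gderiv_two_layer_loss[of X Y W] ev unfolding gderiv_def
    by (intro has_derivative_local_min[of ?f]) (auto simp: eventually_nhds_conv_at)
  then show grad: "loss_gradient X Y W = 0"
    by (metis inner_eq_zero_iff)
  define R1 where "R1 = residual_derivative X W U"
  define R2 where "R2 = fst U ** snd U ** X"
  let ?R = "residual X Y W"
  define q where "q t = (R1 \<bullet> R1 / 2 + ?R \<bullet> R2) + t * (R1 \<bullet> R2) + t\<^sup>2 * (R2 \<bullet> R2 / 2)" for t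
  have R_orth: "?R \<bullet> R1 = 0"
    using grad inner_loss_gradient[of X Y W U] by (simp add: R1_def)
  have residual_line: "residual X Y (W + t *\<^sub>R U) = ?R + t *\<^sub>R R1 + t\<^sup>2 *\<^sub>R R2" for t
    by (simp add: residual_def R1_def R2_def residual_derivative_def matrix_mult.add_left
        matrix_mult.add_right matrix_mult.scaleR_left matrix_mult.scaleR_right matrix_mul_assoc
        scaleR_add_right power2_eq_square)
  have line: "?f (W + t *\<^sub>R U) = ?f W + t\<^sup>2 * q t" for t
  proof -
    have "(?R + t *\<^sub>R R1 + t\<^sup>2 *\<^sub>R R2) \<bullet> (?R + t *\<^sub>R R1 + t\<^sup>2 *\<^sub>R R2) = ?R \<bullet> ?R + t\<^sup>2 * (2 * q t)"
      by (simp add: q_def inner_add_left inner_add_right R_orth inner_commute[of R1 ?R]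
          inner_commute[of R2 ?R] inner_commute[of R2 R1] power2_eq_square) (simp add: algebra_simps)
    then show ?thesis
      by (simp add: two_layer_loss_residual residual_line add_divide_distrib)
  qed
  have "((\<lambda>t. W + t *\<^sub>R U) \<longlongrightarrow> W + 0 *\<^sub>R U) (at 0)"
    by (intro tendsto_intros)
  then have "((\<lambda>t. W + t *\<^sub>R U) \<longlongrightarrow> W) (at 0)" by simp
  then have "\<forall>\<^sub>F t in at 0. ?f W \<le> ?f (W + t *\<^sub>R U)"
    by (rule eventually_compose_filterlim[OF ev])
  moreover have "\<forall>\<^sub>F t in at 0. t \<noteq> (0::real)" by (simp add: eventually_at_filter)
  ultimately have "\<forall>\<^sub>F t in at 0. 0 \<le> q t"
    by eventually_elim (auto simp: line zero_le_mult_iff)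
  moreover have "(q \<longlongrightarrow> (R1 \<bullet> R1 / 2 + ?R \<bullet> R2) + 0 * (R1 \<bullet> R2) + 0\<^sup>2 * (R2 \<bullet> R2 / 2)) (at 0)"
    unfolding q_def[abs_def] by (intro tendsto_intros)
  ultimately have "0 \<le> (R1 \<bullet> R1 / 2 + ?R \<bullet> R2) + 0 * (R1 \<bullet> R2) + 0\<^sup>2 * (R2 \<bullet> R2 / 2)"
    by (intro tendsto_lowerbound[of q _ "at 0"]) auto
  then show "0 \<le> loss_hessian X Y W U \<bullet> U"
    unfolding inner_loss_hessian inner_add_right R1_def R2_def by simp
qed

section \<open>Second order points are global minima\<close>

text \<open>The orthogonal projection of \<open>Y\<close> to the space of matrices \<open>Q X\<close>. It takes the place of
  \<open>Y X\<^sup>T (X X\<^sup>T)\<^sup>-\<^sup>1 X\<close> and exists also when \<open>X X\<^sup>T\<close> is singular.\<close>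

lemma least_squares_decomposition:
  fixes X :: "real ^ 'n ^ 'd" and Y :: "real ^ 'n ^ 'm"
  obtains M N where "Y = M ** X + N" "N ** transpose X = 0"
proof -
  let ?S = "range (\<lambda>Q :: real ^ 'd ^ 'm. Q ** X)"
  have "subspace ?S"
    by (intro linear_subspace_image bounded_linear.linear[OF matrix_mult.bounded_linear_left]
        subspace_UNIV)
  then have span: "span ?S = ?S" by (simp add: span_eq_iff)
  obtain Z N where "Z \<in> span ?S" and orth: "\<And>V. V \<in> span ?S \<Longrightarrow> orthogonal N V"
      and Y: "Y = Z + N"
    using orthogonal_subspace_decomp_exists by blast
  then obtain M where "Z = M ** X" using span by auto
  have "(N ** transpose X) \<bullet> (N ** transpose X) = N \<bullet> (N ** transpose X ** X)"
    by (simp only: inner_matrix_mult_left_factor[symmetric] inner_commute)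
  also have "\<dots> = 0"
    using orth[of "N ** transpose X ** X"] span by (auto simp: orthogonal_def)
  finally show ?thesis using that Y \<open>Z = M ** X\<close> by auto
qed

lemma psd_critical_point_global_minimum:
  fixes X :: "real ^ 'n ^ 'd0" and Y :: "real ^ 'n ^ 'd2"
    and W :: "(real ^ 'd1 ^ 'd2) \<times> (real ^ 'd0 ^ 'd1)"
  assumes grad: "loss_gradient X Y W = 0"
    and psd: "\<And>U. 0 \<le> loss_hessian X Y W U \<bullet> U"
  shows "global_minimum (two_layer_loss X Y) W"
proof -
  obtain W2 W1 where W: "W = (W2, W1)" by fastforce
  obtain M N where Y: "Y = M ** X + N" and N: "N ** transpose X = 0"
    by (rule least_squares_decomposition)
  have N_orth: "N \<bullet> (Q ** X) = 0" for Q
    using inner_matrix_mult_left_factor[of Q X N] by (simp add: N inner_commute)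
  have loss: "two_layer_loss X Y (V2, V1)
      = (norm (V2 ** (V1 ** X) - M ** X))\<^sup>2 / 2 + (norm N)\<^sup>2 / 2" for V2 V1
  proof -
    define P where "P = (V2 ** V1 - M) ** X"
    have P: "V2 ** V1 ** X - Y = P - N" "V2 ** (V1 ** X) - M ** X = P"
      by (simp_all add: P_def Y matrix_mult.diff_left matrix_mul_assoc)
    have "N \<bullet> P = 0" unfolding P_def by (rule N_orth)
    then have "(norm (P - N))\<^sup>2 = (norm P)\<^sup>2 + (norm N)\<^sup>2"
      by (simp add: power2_norm_eq_inner inner_diff_left inner_diff_right inner_commute[of P N])
    then show ?thesis
      by (simp add: two_layer_loss_def P add_divide_distrib)
  qed
  define D where "D = M - W2 ** W1"
  have R: "residual X Y W = - (D ** X) - N"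
    by (simp add: W Y residual_def D_def matrix_mult.diff_left)
  have RX: "residual X Y W ** transpose X = - (D ** X ** transpose X)"
    by (simp add: R matrix_mult.diff_left matrix_mult.minus_left N)
  have EA: "(D ** X) ** transpose (W1 ** X) = 0"
  proof -
    have "residual X Y W ** transpose X ** transpose W1 = 0"
      using grad by (simp add: loss_gradient_def W matrix_transpose_mul matrix_mul_assoc zero_prod_def)
    then show ?thesis
      by (simp add: RX matrix_mult.minus_left matrix_transpose_mul matrix_mul_assoc)
  qed
  \<comment> \<open>The gradient only yields this equation multiplied by \<open>X\<^sup>T\<close>; the factor can be dropped because
    the left hand side is itself a multiple of \<open>X\<close>.\<close>
  have BE: "transpose W2 ** (D ** X) = 0"
  proof -
    let ?G = "transpose W2 ** (D ** X)"
    have "transpose W2 ** (residual X Y W ** transpose X) = 0"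
      using grad by (simp add: loss_gradient_def W zero_prod_def)
    then have G: "?G ** transpose X = 0"
      by (simp add: RX matrix_mult.minus_right matrix_mul_assoc)
    have "?G \<bullet> ?G = ((transpose W2 ** D) ** X) \<bullet> ?G" by (simp add: matrix_mul_assoc)
    also have "\<dots> = 0" unfolding inner_matrix_mult_left_factor G by simp
    finally show ?thesis by simp
  qed
  have "0 \<le> (norm (U2 ** (W1 ** X) + W2 ** (U1 ** X)))\<^sup>2 - 2 * ((D ** X) \<bullet> (U2 ** U1 ** X))" for U2 U1
  proof -
    have "residual X Y W \<bullet> (U2 ** U1 ** X) = - ((D ** X) \<bullet> (U2 ** U1 ** X))"
      by (simp add: R inner_diff_left N_orth)
    moreover have "residual_derivative X W (U2, U1) = U2 ** (W1 ** X) + W2 ** (U1 ** X)"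
      by (simp add: residual_derivative_def W)
    ultimately show ?thesis
      using psd[of "(U2, U1)"] unfolding inner_loss_hessian power2_norm_eq_inner fst_conv snd_conv
      by (simp only: inner_add_right[of "residual X Y W"])
  qed
  note gap = second_order_singular_value_gap[OF EA this]
  have "norm (W2 ** (W1 ** X) - M ** X) \<le> norm (V2 ** (V1 ** X) - M ** X)"
    for V2 :: "real ^ 'd1 ^ 'd2" and V1 :: "real ^ 'd0 ^ 'd1"
  proof (cases "inj ((*v) W2)")
    case True
    have "(norm (W2 *v y))\<^sup>2 * (norm (q v* (D ** X)))\<^sup>2
        \<le> (norm q)\<^sup>2 * (norm ((W2 *v y) v* (W2 ** (W1 ** X))))\<^sup>2" for q y
    proof (cases "W2 *v y = 0")
      case False
      \<comment> \<open>With this \<open>x\<close>, the vector \<open>A\<^sup>T x\<close> is the image of \<open>W2 y\<close> under the transpose of \<open>W2 W1 X\<close>.\<close>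
      let ?x = "(W2 *v y) v* W2"
      have "?x \<bullet> y = (norm (W2 *v y))\<^sup>2" by (simp add: dot_lmul_matrix power2_norm_eq_inner)
      then have "(norm (W2 *v y))\<^sup>2 * ((norm (W2 *v y))\<^sup>2 * (norm (q v* (D ** X)))\<^sup>2)
          \<le> (norm (W2 *v y))\<^sup>2 * ((norm q)\<^sup>2 * (norm (?x v* (W1 ** X)))\<^sup>2)"
        using gap[of ?x y q] by (simp add: power2_eq_square mult_ac)
      then have "(norm (W2 *v y))\<^sup>2 * (norm (q v* (D ** X)))\<^sup>2
          \<le> (norm q)\<^sup>2 * (norm (?x v* (W1 ** X)))\<^sup>2"
        by (rule mult_left_le_imp_le) (use False in simp)
      then show ?thesis by (simp only: vector_matrix_mul_assoc)
    qed simp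
    then have "norm (D ** X) \<le> norm (V2 ** (V1 ** X) - (W2 ** (W1 ** X) + D ** X))"
      by (rule low_rank_approximation_optimal[OF True BE EA])
    moreover have "W2 ** (W1 ** X) + D ** X = M ** X"
      by (simp add: D_def matrix_mult.diff_left matrix_mul_assoc)
    ultimately show ?thesis
      by (metis add_diff_cancel_left' norm_minus_commute)
  next
    case False
    then obtain v where v: "v \<noteq> 0" "W2 *v v = 0"
      by (metis full_rank_injective matrix_nonfull_linear_equations_eq)
    have "q v* (D ** X) = 0" for q
      using gap[of v v q] v by (simp add: mult_le_0_iff)
    then have "q \<bullet> ((D ** X) *v z) = 0" for q z
      by (simp add: dot_lmul_matrix[symmetric])
    then have "D ** X = 0"
      unfolding matrix_eq by (metis inner_eq_zero_iff matrix_vector_mult_0)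
    then have "W2 ** (W1 ** X) = M ** X"
      by (simp add: D_def matrix_mult.diff_left matrix_mul_assoc)
    then show ?thesis by simp
  qed
  then show ?thesis
    unfolding global_minimum_def W by (auto simp: loss intro!: divide_right_mono power_mono)
qed

theorem theorem14:
  fixes X :: "real ^ 'n ^ 'd0" and Y :: "real ^ 'n ^ 'd2"
  shows "(\<forall>W :: (real ^ 'd1 ^ 'd2) \<times> (real ^ 'd0 ^ 'd1).
            local_minimum (two_layer_loss X Y) W \<longrightarrow> global_minimum (two_layer_loss X Y) W) \<and>
         (\<forall>W :: (real ^ 'd1 ^ 'd2) \<times> (real ^ 'd0 ^ 'd1).
            degenerate W \<and> saddle_point (two_layer_loss X Y) W \<longrightarrow>
            second_order_saddle (two_layer_loss X Y) W)"
proof (intro conjI allI impI)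
  fix W :: "(real ^ 'd1 ^ 'd2) \<times> (real ^ 'd0 ^ 'd1)"
  assume "local_minimum (two_layer_loss X Y) W"
  then show "global_minimum (two_layer_loss X Y) W"
    by (intro psd_critical_point_global_minimum local_minimum_second_order_conditions)
next
  fix W :: "(real ^ 'd1 ^ 'd2) \<times> (real ^ 'd0 ^ 'd1)"
  assume "degenerate W \<and> saddle_point (two_layer_loss X Y) W"
  then have crit: "critical_point (two_layer_loss X Y) W"
    and not_min: "\<not> local_minimum (two_layer_loss X Y) W"
    by (auto simp: saddle_point_def)
  have "\<not> global_minimum (two_layer_loss X Y) W"
    using not_min unfolding global_minimum_def local_minimum_def by (metis always_eventually)
  then obtain U where U: "loss_hessian X Y W U \<bullet> U < 0"
    using psd_critical_point_global_minimum[of X Y W] crit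
    unfolding critical_point_iff_gradient by (meson not_le)
  have "loss_hessian X Y W V \<bullet> V' = V \<bullet> loss_hessian X Y W V'" for V V'
    by (simp add: inner_commute[of V] inner_loss_hessian inner_commute[of "residual_derivative X W V"]
        add.commute)
  moreover have "linear (loss_hessian X Y W)"
    using has_derivative_loss_gradient has_derivative_linear by blast
  ultimately obtain c where "c < 0" "eigenvalue_of (loss_hessian X Y W) c"
    using self_adjoint_negative_eigenvalue[of "loss_hessian X Y W" U] U by metis
  then show "second_order_saddle (two_layer_loss X Y) W"
    unfolding second_order_saddle_def using crit has_hessian_two_layer_loss by blast
qed

end
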